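(* Let $W_3$ be the $5$-dimensional complex nilpotent Lie algebra with basis $e_1,\dots,e_5$ and brackets $[e_3,e_4]=e_2$, $[e_3,e_5]=e_1$, $[e_4,e_5]=e_3$ (extended skew-symmetrically, all others zero). Let $\mathfrak{d}$ be the $4$-dimensional diamond Lie algebra $[e_1,e_2]=e_3$, $[e_1,e_3]=-e_2$, $[e_2,e_3]=e_4$. Then $W_3$ deforms in two different ways to the Lie algebra $\mathfrak{d}\oplus\mathbb{C}$, and also has a deformation to $\mathfrak{sl}(2,\mathbb{C})\oplus\mathbb{C}^2$. Moreover, $W_3$ has two isomorphic metric nilpotent Leibniz algebra deformations: one is $\widetilde{W_3}$, with the nonzero brackets of $W_3$ and the extra nontrivial bracket $[e_5,e_5]=e_2$; the other is $\widetilde{W_3}'$, with the nonzero brackets of $W_3$ and the extra nonzero bracket $[e_4,e_4]=e_1$. Here $\widetilde{W_3}$ is isomorphic to $\widetilde{W_3}'$.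
   Context: All algebras are over $\mathbb{C}$. A left (resp. right) Leibniz algebra is a vector space $\mathfrak{L}$ with a bilinear bracket satisfying $[x,[y,z]]=[[x,y],z]+[y,[x,z]]$ (resp. $[x,[y,z]]=[[x,y],z]-[[x,z],y]$); a Leibniz algebra is one or the other. Lie algebras are Leibniz algebras. $\mathfrak{L}$ is nilpotent if $\mathfrak{L}^n=0$ for some $n$, where $\mathfrak{L}^1=\mathfrak{L}$, $\mathfrak{L}^{k+1}=[\mathfrak{L}^k,\mathfrak{L}]$. A bilinear form $B$ on $\mathfrak{L}$ is invariant if $B([x,y],z)=B(x,[y,z])$ for all $x,y,z$. $\mathfrak{L}$ is metric if it has a non-degenerate symmetric invariant bilinear form. A (formal $1$-parameter, Leibniz) deformation of $(\mathfrak{L},\mu_0)$ is a Leibniz bracket $\mu_t=\mu_0+t\phi_1+t^2\phi_2+\cdots$ on $\mathfrak{L}\otimes\mathbb{C}[[t]]$, with $\phi_i$ bilinear maps $\mathfrak{L}\times\mathfrak{L}\to\mathfrak{L}$; $\phi_1$ is then a Leibniz $2$-cocycle. $\mathfrak{L}$ deforms to a Leibniz algebra $\mathfrak{N}$ if there is a deformation $\mu_t$, polynomial in $t$, with $(\mathfrak{L},\mu_t)\cong\mathfrak{N}$ for all nonzero $t$ near $0$. Deformations to $\mathfrak{N}$ are considered different ways of deforming when their infinitesimal parts $\phi_1$ are non-equivalent cocycles, i.e. have linearly independent classes modulo coboundaries $(x,y)\mapsto[x,f(y)]+[f(x),y]-f([x,y])$, $f$ linear. $\mathfrak{sl}(2,\mathbb{C})$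 has brackets $[e_1,e_2]=e_3$, $[e_2,e_3]=2e_2$, $[e_1,e_3]=-2e_1$, and $\mathbb{C}^k$ is the $k$-dimensional abelian algebra. *)

theory Defs
  imports "HOL-Analysis.Analysis" "HOL-Computational_Algebra.Formal_Power_Series"
begin

text \<open>
  An algebra of dimension \<open>n\<close> over a ring \<open>'a\<close> is a bracket on the free module
  \<open>'a ^ 'n\<close>.  The coefficient ring is \<open>complex\<close> for the algebras themselves and
  \<open>complex fps\<close> for their formal deformations.
\<close>

definition bilinear_map ::
  "('a::comm_ring_1 \<Rightarrow> 'b::ab_group_add \<Rightarrow> 'b) \<Rightarrow> ('a \<Rightarrow> 'c::ab_group_add \<Rightarrow> 'c) \<Rightarrow> ('b \<Rightarrow> 'b \<Rightarrow> 'c) \<Rightarrow> bool"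
  where "bilinear_map s1 s2 f \<longleftrightarrow>
    (\<forall>x. module_hom s1 s2 (\<lambda>y. f x y)) \<and> (\<forall>y. module_hom s1 s2 (\<lambda>x. f x y))"

definition left_leibniz :: "('v::ab_group_add \<Rightarrow> 'v \<Rightarrow> 'v) \<Rightarrow> bool"
  where "left_leibniz \<mu> \<longleftrightarrow> (\<forall>x y z. \<mu> x (\<mu> y z) = \<mu> (\<mu> x y) z + \<mu> y (\<mu> x z))"

definition right_leibniz :: "('v::ab_group_add \<Rightarrow> 'v \<Rightarrow> 'v) \<Rightarrow> bool"
  where "right_leibniz \<mu> \<longleftrightarrow> (\<forall>x y z. \<mu> x (\<mu> y z) = \<mu> (\<mu> x y) z - \<mu> (\<mu> x z) y)"

definition leibniz_algebra :: "('a::comm_ring_1 ^ 'n \<Rightarrow> 'a ^ 'n \<Rightarrow> 'a ^ 'n) \<Rightarrow> bool"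
  where "leibniz_algebra \<mu> \<longleftrightarrow> bilinear_map (*s) (*s) \<mu> \<and> (left_leibniz \<mu> \<or> right_leibniz \<mu>)"

definition lie_algebra :: "('a::comm_ring_1 ^ 'n \<Rightarrow> 'a ^ 'n \<Rightarrow> 'a ^ 'n) \<Rightarrow> bool"
  where "lie_algebra \<mu> \<longleftrightarrow> bilinear_map (*s) (*s) \<mu> \<and> (\<forall>x. \<mu> x x = 0) \<and>
    (\<forall>x y z. \<mu> x (\<mu> y z) + \<mu> y (\<mu> z x) + \<mu> z (\<mu> x y) = 0)"

text \<open>The exponents are shifted by one: \<open>lower_central \<mu> k\<close> is the term \<open>L\<^sup>k\<^sup>+\<^sup>1\<close> of the
  series \<open>L\<^sup>1 = L\<close>, \<open>L\<^sup>k\<^sup>+\<^sup>1 = [L\<^sup>k, L]\<close>.\<close>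

primrec lower_central :: "(complex ^ 'n \<Rightarrow> complex ^ 'n \<Rightarrow> complex ^ 'n) \<Rightarrow> nat \<Rightarrow> (complex ^ 'n) set"
  where
    "lower_central \<mu> 0 = UNIV"
  | "lower_central \<mu> (Suc k) = vec.span {\<mu> x y | x y. x \<in> lower_central \<mu> k}"

definition nilpotent_algebra :: "(complex ^ 'n \<Rightarrow> complex ^ 'n \<Rightarrow> complex ^ 'n) \<Rightarrow> bool"
  where "nilpotent_algebra \<mu> \<longleftrightarrow> (\<exists>k. lower_central \<mu> k = {0})"

definition metric_algebra :: "(complex ^ 'n \<Rightarrow> complex ^ 'n \<Rightarrow> complex ^ 'n) \<Rightarrow> bool"
  where "metric_algebra \<mu> \<longleftrightarrow> (\<exists>B :: complex ^ 'n \<Rightarrow> complex ^ 'n \<Rightarrow> complex.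
    bilinear_map (*s) (*) B \<and>
    (\<forall>x y. B x y = B y x) \<and>
    (\<forall>x. (\<forall>y. B x y = 0) \<longrightarrow> x = 0) \<and>
    (\<forall>x y z. B (\<mu> x y) z = B x (\<mu> y z)))"

definition isomorphic_algebras ::
  "(complex ^ 'm \<Rightarrow> complex ^ 'm \<Rightarrow> complex ^ 'm) \<Rightarrow> (complex ^ 'n \<Rightarrow> complex ^ 'n \<Rightarrow> complex ^ 'n) \<Rightarrow> bool"
  where "isomorphic_algebras \<mu> \<nu> \<longleftrightarrow>
    (\<exists>f. Vector_Spaces.linear (*s) (*s) f \<and> bij f \<and> (\<forall>x y. f (\<mu> x y) = \<nu> (f x) (f y)))"

definition direct_sum ::
  "(complex ^ 'm \<Rightarrow> complex ^ 'm \<Rightarrow> complex ^ 'm) \<Rightarrow> (complex ^ 'n \<Rightarrow> complex ^ 'n \<Rightarrow> complex ^ 'n) \<Rightarrow>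
    complex ^ ('m + 'n) \<Rightarrow> complex ^ ('m + 'n) \<Rightarrow> complex ^ ('m + 'n)"
  where "direct_sum \<mu> \<nu> x y = (\<chi> k. case k of
      Inl i \<Rightarrow> \<mu> (\<chi> a. x $ Inl a) (\<chi> a. y $ Inl a) $ i
    | Inr j \<Rightarrow> \<nu> (\<chi> b. x $ Inr b) (\<chi> b. y $ Inr b) $ j)"

definition abelian :: "complex ^ 'n \<Rightarrow> complex ^ 'n \<Rightarrow> complex ^ 'n"
  where "abelian x y = 0"


text \<open>
  A formal deformation is given by the sequence \<open>\<phi> 0, \<phi> 1, \<phi> 2, \<dots>\<close> of its coefficients,
  where \<open>\<phi> 0\<close> is the undeformed bracket.  With \<open>L = complex ^ 'n\<close>, the tensor product of
  \<open>L\<close> with the power series ring is \<open>complex fps ^ 'n\<close>, and \<open>formal_bracket \<phi>\<close> is the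
  bracket \<open>\<phi> 0 + t \<phi> 1 + t\<^sup>2 \<phi> 2 + \<dots>\<close> on it, extended bilinearly over the power series
  ring from the basis of \<open>L\<close>.
\<close>

definition formal_bracket ::
  "(nat \<Rightarrow> complex ^ 'n \<Rightarrow> complex ^ 'n \<Rightarrow> complex ^ 'n) \<Rightarrow>
    complex fps ^ 'n \<Rightarrow> complex fps ^ 'n \<Rightarrow> complex fps ^ 'n"
  where "formal_bracket \<phi> X Y =
    (\<Sum>i\<in>UNIV. \<Sum>j\<in>UNIV. (X $ i * Y $ j) *s (\<chi> l. Abs_fps (\<lambda>k. \<phi> k (axis i 1) (axis j 1) $ l)))"

definition deformation ::
  "(complex ^ 'n \<Rightarrow> complex ^ 'n \<Rightarrow> complex ^ 'n) \<Rightarrow> (nat \<Rightarrow> complex ^ 'n \<Rightarrow> complex ^ 'n \<Rightarrow> complex ^ 'n) \<Rightarrow> bool"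
  where "deformation \<mu> \<phi> \<longleftrightarrow> leibniz_algebra \<mu> \<and> \<phi> 0 = \<mu> \<and>
    (\<forall>k. bilinear_map (*s) (*s) (\<phi> k)) \<and> leibniz_algebra (formal_bracket \<phi>)"

definition polynomial_family :: "(nat \<Rightarrow> complex ^ 'n \<Rightarrow> complex ^ 'n \<Rightarrow> complex ^ 'n) \<Rightarrow> bool"
  where "polynomial_family \<phi> \<longleftrightarrow> finite {k. \<phi> k \<noteq> (\<lambda>x y. 0)}"

text \<open>Only meaningful if \<open>polynomial_family \<phi>\<close>; otherwise the sum is over an infinite set.\<close>

definition specialization ::
  "(nat \<Rightarrow> complex ^ 'n \<Rightarrow> complex ^ 'n \<Rightarrow> complex ^ 'n) \<Rightarrow> complex \<Rightarrow> complex ^ 'n \<Rightarrow> complex ^ 'n \<Rightarrow> complex ^ 'n"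
  where "specialization \<phi> t x y = (\<Sum>k\<in>{k. \<phi> k \<noteq> (\<lambda>x y. 0)}. t ^ k *s \<phi> k x y)"

definition deformation_to ::
  "(complex ^ 'm \<Rightarrow> complex ^ 'm \<Rightarrow> complex ^ 'm) \<Rightarrow> (nat \<Rightarrow> complex ^ 'm \<Rightarrow> complex ^ 'm \<Rightarrow> complex ^ 'm) \<Rightarrow>
    (complex ^ 'n \<Rightarrow> complex ^ 'n \<Rightarrow> complex ^ 'n) \<Rightarrow> bool"
  where "deformation_to \<mu> \<phi> \<nu> \<longleftrightarrow> deformation \<mu> \<phi> \<and> leibniz_algebra \<nu> \<and> polynomial_family \<phi> \<and>
    (\<forall>\<^sub>F t in at 0. isomorphic_algebras (specialization \<phi> t) \<nu>)"

definition coboundary ::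
  "(complex ^ 'n \<Rightarrow> complex ^ 'n \<Rightarrow> complex ^ 'n) \<Rightarrow> (complex ^ 'n \<Rightarrow> complex ^ 'n \<Rightarrow> complex ^ 'n) \<Rightarrow> bool"
  where "coboundary \<mu> c \<longleftrightarrow> (\<exists>f. Vector_Spaces.linear (*s) (*s) f \<and>
    (\<forall>x y. c x y = \<mu> x (f y) + \<mu> (f x) y - f (\<mu> x y)))"

definition independent_classes ::
  "(complex ^ 'n \<Rightarrow> complex ^ 'n \<Rightarrow> complex ^ 'n) \<Rightarrow> (complex ^ 'n \<Rightarrow> complex ^ 'n \<Rightarrow> complex ^ 'n) \<Rightarrow>
    (complex ^ 'n \<Rightarrow> complex ^ 'n \<Rightarrow> complex ^ 'n) \<Rightarrow> bool"
  where "independent_classes \<mu> c d \<longleftrightarrow>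
    (\<forall>a b. coboundary \<mu> (\<lambda>x y. a *s c x y + b *s d x y) \<longrightarrow> a = 0 \<and> b = 0)"

text \<open>
  Multiplication tables.  \<open>lie_table c\<close> extends the brackets \<open>c i j\<close> of basis vectors
  skew-symmetrically and bilinearly; \<open>c\<close> must list each nonzero bracket in only one of its
  two orders.  In the index type \<open>n\<close> (\<open>n = 3, 4, 5\<close>) the numeral \<open>n\<close> equals \<open>0\<close>, so that
  \<open>1, \<dots>, n\<close> are the \<open>n\<close> distinct indices.
\<close>

definition lie_table :: "('n \<Rightarrow> 'n \<Rightarrow> complex ^ 'n) \<Rightarrow> complex ^ 'n \<Rightarrow> complex ^ 'n \<Rightarrow> complex ^ 'n"
  where "lie_table c x y = (\<Sum>i\<in>UNIV. \<Sum>j\<in>UNIV. (x $ i * y $ j) *s (c i j - c j i))"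

abbreviation e :: "'n \<Rightarrow> complex ^ 'n"
  where "e i \<equiv> axis i 1"

definition W3 :: "complex ^ 5 \<Rightarrow> complex ^ 5 \<Rightarrow> complex ^ 5"
  where "W3 = lie_table (\<lambda>i j.
    if (i, j) = (3, 4) then e 2
    else if (i, j) = (3, 5) then e 1
    else if (i, j) = (4, 5) then e 3
    else 0)"

definition diamond :: "complex ^ 4 \<Rightarrow> complex ^ 4 \<Rightarrow> complex ^ 4"
  where "diamond = lie_table (\<lambda>i j.
    if (i, j) = (1, 2) then e 3
    else if (i, j) = (1, 3) then - e 2
    else if (i, j) = (2, 3) then e 4
    else 0)"

definition sl2 :: "complex ^ 3 \<Rightarrow> complex ^ 3 \<Rightarrow> complex ^ 3"
  where "sl2 = lie_table (\<lambda>i j.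
    if (i, j) = (1, 2) then e 3
    else if (i, j) = (2, 3) then 2 *s e 2
    else if (i, j) = (1, 3) then - 2 *s e 1
    else 0)"

definition W3_tilde :: "complex ^ 5 \<Rightarrow> complex ^ 5 \<Rightarrow> complex ^ 5"
  where "W3_tilde x y = W3 x y + (x $ 5 * y $ 5) *s e 2"

definition W3_tilde' :: "complex ^ 5 \<Rightarrow> complex ^ 5 \<Rightarrow> complex ^ 5"
  where "W3_tilde' x y = W3 x y + (x $ 4 * y $ 4) *s e 1"

end

theory Submission imports Defs begin

text \<open>
  \<open>W3\<close> carries the invariant form \<open>B\<close> with \<open>B(e3, e3) = 1\<close>, \<open>B(e1, e4) = -1\<close>, \<open>B(e2, e5) = 1\<close>,
  and \<open>B([x, y], z)\<close> is the decomposable 3-form \<open>e3\<^sup>* \<and> e4\<^sup>* \<and> e5\<^sup>*\<close>, whose factors span a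
  space of rank 1 for \<open>B\<close>.  Any decomposable 3-form defines a Lie bracket in the same way.
  Moving \<open>e4\<^sup>*\<close> to \<open>e4\<^sup>* + t e1\<^sup>*\<close> or \<open>e5\<^sup>*\<close> to \<open>e5\<^sup>* + t e2\<^sup>*\<close> raises the rank to 2, which
  gives the diamond algebra plus a line; moving both raises it to 3, which gives
  \<open>sl(2)\<close> plus a plane.  Adding a multiple of the cube of \<open>e5\<^sup>*\<close> or \<open>e4\<^sup>*\<close> to the 3-form
  gives the two metric Leibniz algebras.
\<close>

section \<open>Coordinates in dimensions 4 and 5\<close>

lemma exhaust_5:
  fixes x :: 5
  shows "x = 1 \<or> x = 2 \<or> x = 3 \<or> x = 4 \<or> x = 5"
proof (induct x)
  case (of_int z)
  then have "z = 0 \<or> z = 1 \<or> z = 2 \<or> z = 3 \<or> z = 4" by fastforce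
  then show ?case by auto
qed

lemma forall_5: "(\<forall>i::5. P i) \<longleftrightarrow> P 1 \<and> P 2 \<and> P 3 \<and> P 4 \<and> P 5"
  by (metis exhaust_5)

lemma UNIV_5: "UNIV = {1, 2, 3, 4, 5::5}"
  using exhaust_5 by auto

lemma sum_5: "sum f (UNIV::5 set) = f 1 + f 2 + f 3 + f 4 + f 5"
  unfolding UNIV_5 by (simp add: ac_simps)

lemma vector_4 [simp]:
  "(vector [a, b, c, d] :: 'a::zero ^ 4) $ 1 = a" "(vector [a, b, c, d] :: 'a::zero ^ 4) $ 2 = b"
  "(vector [a, b, c, d] :: 'a::zero ^ 4) $ 3 = c" "(vector [a, b, c, d] :: 'a::zero ^ 4) $ 4 = d"
  by (simp_all add: vector_def)

lemma vector_5 [simp]: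
  "(vector [a, b, c, d, k] :: 'a::zero ^ 5) $ 1 = a" "(vector [a, b, c, d, k] :: 'a::zero ^ 5) $ 2 = b"
  "(vector [a, b, c, d, k] :: 'a::zero ^ 5) $ 3 = c" "(vector [a, b, c, d, k] :: 'a::zero ^ 5) $ 4 = d"
  "(vector [a, b, c, d, k] :: 'a::zero ^ 5) $ 5 = k"
  by (simp_all add: vector_def)

section \<open>Bilinear maps and Lie algebras\<close>

lemma module_vec: "module ((*s) :: 'a::comm_ring_1 \<Rightarrow> 'a ^ 'n \<Rightarrow> 'a ^ 'n)"
  by unfold_locales (simp_all add: vec_eq_iff algebra_simps)

lemma module_mult: "module ((*) :: 'a::comm_ring_1 \<Rightarrow> 'a \<Rightarrow> 'a)"
  by unfold_locales (simp_all add: algebra_simps)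

lemma bilinear_map_vecI:
  fixes f :: "'a::comm_ring_1 ^ 'n \<Rightarrow> 'a ^ 'n \<Rightarrow> 'a ^ 'm"
  assumes "\<And>x y z. f (x + y) z = f x z + f y z" "\<And>x y z. f x (y + z) = f x y + f x z"
    "\<And>c x y. f (c *s x) y = c *s f x y" "\<And>c x y. f x (c *s y) = c *s f x y"
  shows "bilinear_map (*s) (*s) f"
  unfolding bilinear_map_def module_hom_def module_hom_axioms_def
  using assms by (auto intro: module_vec)

lemma bilinear_map_formI:
  fixes f :: "'a::comm_ring_1 ^ 'n \<Rightarrow> 'a ^ 'n \<Rightarrow> 'a"
  assumes "\<And>x y z. f (x + y) z = f x z + f y z" "\<And>x y z. f x (y + z) = f x y + f x z"
    "\<And>c x y. f (c *s x) y = c * f x y" "\<And>c x y. f x (c *s y) = c * f x y"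
  shows "bilinear_map (*s) (*) f"
  unfolding bilinear_map_def module_hom_def module_hom_axioms_def
  using assms by (auto intro: module_vec module_mult)

lemma
  assumes "bilinear_map (*s) (*s) f"
  shows bilinear_map_add_left: "f (x + y) z = f x z + f y z"
    and bilinear_map_add_right: "f x (y + z) = f x y + f x z"
    and bilinear_map_scale_left: "f (c *s x) y = c *s f x y"
    and bilinear_map_scale_right: "f x (c *s y) = c *s f x y"
  using assms unfolding bilinear_map_def module_hom_def module_hom_axioms_def by auto

lemma bilinear_map_sum_left:
  assumes "bilinear_map (*s) (*s) f"
  shows "f (\<Sum>i\<in>A. g i) y = (\<Sum>i\<in>A. f (g i) y)"
  using assms module_hom.sum[of "(*s)" "(*s)" "\<lambda>x. f x y" g A] unfolding bilinear_map_def by blast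

lemma bilinear_map_sum_right:
  assumes "bilinear_map (*s) (*s) f"
  shows "f x (\<Sum>i\<in>A. g i) = (\<Sum>i\<in>A. f x (g i))"
  using assms module_hom.sum[of "(*s)" "(*s)" "f x" g A] unfolding bilinear_map_def by blast

lemma vec_expansion:
  fixes x :: "'a::comm_ring_1 ^ 'n"
  shows "x = (\<Sum>i\<in>UNIV. x $ i *s axis i 1)"
  by (simp add: vec_eq_iff axis_def if_distrib sum.If_cases cong: if_cong)

lemma lie_algebra_imp_leibniz_algebra:
  assumes "lie_algebra \<mu>"
  shows "leibniz_algebra \<mu>"
proof -
  have bil: "bilinear_map (*s) (*s) \<mu>" and alt: "\<mu> x x = 0"
    and jac: "\<mu> x (\<mu> y z) + \<mu> y (\<mu> z x) + \<mu> z (\<mu> x y) = 0" for x y z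
    using assms by (auto simp: lie_algebra_def)
  have neg_right: "\<mu> x (- y) = - \<mu> x y" for x y
    using bilinear_map_scale_right[OF bil, of x "-1" y] by (simp add: vector_sneg_minus1[symmetric])
  have skew: "\<mu> y x = - \<mu> x y" for x y
  proof -
    have "\<mu> x x + \<mu> y x + (\<mu> x y + \<mu> y y) = \<mu> (x + y) (x + y)"
      by (simp only: bilinear_map_add_left[OF bil] bilinear_map_add_right[OF bil])
    then have "\<mu> y x + \<mu> x y = 0"
      by (simp only: alt add_0_left add_0_right)
    then show ?thesis
      by (simp only: eq_neg_iff_add_eq_0)
  qed
  have "\<mu> x (\<mu> y z) = \<mu> (\<mu> x y) z + \<mu> y (\<mu> x z)" for x y z
  proof -
    have "\<mu> (\<mu> x y) z + \<mu> y (\<mu> x z) = - \<mu> z (\<mu> x y) - \<mu> y (\<mu> z x)"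
      by (simp only: skew[of "\<mu> x y" z] skew[of x z] neg_right diff_conv_add_uminus)
    also have "\<dots> = \<mu> x (\<mu> y z)"
      unfolding diff_eq_eq using jac[of x y z, folded eq_neg_iff_add_eq_0] by (rule sym)
    finally show ?thesis ..
  qed
  with bil show ?thesis unfolding leibniz_algebra_def left_leibniz_def by blast
qed

section \<open>Formal brackets and their coefficients\<close>

definition coeff_family ::
  "(complex fps ^ 'n \<Rightarrow> complex fps ^ 'n \<Rightarrow> complex fps ^ 'n) \<Rightarrow> nat \<Rightarrow>
    complex ^ 'n \<Rightarrow> complex ^ 'n \<Rightarrow> complex ^ 'n"
  where "coeff_family M k x y = (\<chi> l. fps_nth (M (\<chi> i. fps_const (x $ i)) (\<chi> i. fps_const (y $ i)) $ l) k)"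

lemma bilinear_map_coeff_family:
  fixes M :: "complex fps ^ 'n \<Rightarrow> complex fps ^ 'n \<Rightarrow> complex fps ^ 'n"
  assumes bil: "bilinear_map (*s) (*s) M"
  shows "bilinear_map (*s) (*s) (coeff_family M k)"
proof -
  have add: "(\<chi> i. fps_const ((x + y) $ i)) = (\<chi> i. fps_const (x $ i)) + (\<chi> i. fps_const (y $ i))"
    and scale: "(\<chi> i. fps_const ((c *s x) $ i)) = fps_const c *s (\<chi> i. fps_const (x $ i))"
    for x y :: "complex ^ 'n" and c
    by (simp_all add: vec_eq_iff)
  show ?thesis
    by (rule bilinear_map_vecI)
      (simp_all only: coeff_family_def add scale bilinear_map_add_left[OF bil]
        bilinear_map_add_right[OF bil] bilinear_map_scale_left[OF bil]
        bilinear_map_scale_right[OF bil], simp_all add: vec_eq_iff)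
qed

text \<open>A bilinear \<open>M\<close> is fixed by its values on basis vectors, whose entries are
  constant series. The Leibniz identity of a deformation can thus be checked once, over the power
  series ring, instead of order by order.\<close>

lemma formal_bracket_coeff_family:
  fixes M :: "complex fps ^ 'n \<Rightarrow> complex fps ^ 'n \<Rightarrow> complex fps ^ 'n"
  assumes bil: "bilinear_map (*s) (*s) M"
  shows "formal_bracket (coeff_family M) = M"
proof (intro ext)
  fix X Y :: "complex fps ^ 'n"
  have const_axis: "(\<chi> l. fps_const (axis i (1::complex) $ l)) = axis i 1" for i :: 'n
    by (simp add: vec_eq_iff axis_def)
  have M_axis: "M (axis i 1) Y = (\<Sum>j\<in>UNIV. Y $ j *s M (axis i 1) (axis j 1))" for i
    by (subst vec_expansion[of Y])
      (simp add: bilinear_map_sum_right[OF bil] bilinear_map_scale_right[OF bil])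
  have "M X Y = (\<Sum>i\<in>UNIV. X $ i *s M (axis i 1) Y)"
    by (subst vec_expansion[of X])
      (simp add: bilinear_map_sum_left[OF bil] bilinear_map_scale_left[OF bil])
  also have "\<dots> = (\<Sum>i\<in>UNIV. \<Sum>j\<in>UNIV. (X $ i * Y $ j) *s M (axis i 1) (axis j 1))"
    by (simp add: M_axis vec_eq_iff sum_distrib_left mult.assoc)
  finally show "formal_bracket (coeff_family M) X Y = M X Y"
    by (simp add: formal_bracket_def coeff_family_def const_axis fps_nth_inverse)
qed

section \<open>A family of brackets in dimension 5\<close>

text \<open>The trilinear form \<open>B([x, y], z)\<close> of this bracket is
  \<open>e3\<^sup>* \<and> (e4\<^sup>* + \<sigma> e1\<^sup>*) \<and> (e5\<^sup>* + \<tau> e2\<^sup>*)\<close> plus \<open>\<alpha> (e5\<^sup>*)\<^sup>3 - \<beta> (e4\<^sup>*)\<^sup>3\<close>.\<close>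

definition W3_family ::
  "'a::comm_ring_1 \<Rightarrow> 'a \<Rightarrow> 'a \<Rightarrow> 'a \<Rightarrow> 'a ^ 5 \<Rightarrow> 'a ^ 5 \<Rightarrow> 'a ^ 5"
  where "W3_family \<sigma> \<tau> \<alpha> \<beta> x y =
    (let m = (\<lambda>i j. x $ i * y $ j - x $ j * y $ i) in
      vector [m 3 5 + \<tau> * m 3 2 + \<beta> * (x $ 4 * y $ 4),
        m 3 4 + \<sigma> * m 3 1 + \<alpha> * (x $ 5 * y $ 5),
        m 4 5 + \<sigma> * m 1 5 + \<tau> * m 4 2 + \<sigma> * \<tau> * m 1 2,
        \<sigma> * (m 3 5 + \<tau> * m 3 2),
        \<tau> * (m 3 4 + \<sigma> * m 3 1)])"

lemma W3_family_nth [simp]: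
  "W3_family \<sigma> \<tau> \<alpha> \<beta> x y $ 1 = (x $ 3 * y $ 5 - x $ 5 * y $ 3)
    + \<tau> * (x $ 3 * y $ 2 - x $ 2 * y $ 3) + \<beta> * (x $ 4 * y $ 4)"
  "W3_family \<sigma> \<tau> \<alpha> \<beta> x y $ 2 = (x $ 3 * y $ 4 - x $ 4 * y $ 3)
    + \<sigma> * (x $ 3 * y $ 1 - x $ 1 * y $ 3) + \<alpha> * (x $ 5 * y $ 5)"
  "W3_family \<sigma> \<tau> \<alpha> \<beta> x y $ 3 = (x $ 4 * y $ 5 - x $ 5 * y $ 4)
    + \<sigma> * (x $ 1 * y $ 5 - x $ 5 * y $ 1) + \<tau> * (x $ 4 * y $ 2 - x $ 2 * y $ 4)
    + \<sigma> * \<tau> * (x $ 1 * y $ 2 - x $ 2 * y $ 1)"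
  "W3_family \<sigma> \<tau> \<alpha> \<beta> x y $ 4 =
    \<sigma> * ((x $ 3 * y $ 5 - x $ 5 * y $ 3) + \<tau> * (x $ 3 * y $ 2 - x $ 2 * y $ 3))"
  "W3_family \<sigma> \<tau> \<alpha> \<beta> x y $ 5 =
    \<tau> * ((x $ 3 * y $ 4 - x $ 4 * y $ 3) + \<sigma> * (x $ 3 * y $ 1 - x $ 1 * y $ 3))"
  by (simp_all add: W3_family_def Let_def)

lemma bilinear_map_W3_family: "bilinear_map (*s) (*s) (W3_family \<sigma> \<tau> \<alpha> \<beta>)"
  by (rule bilinear_map_vecI) (simp_all add: vec_eq_iff forall_5 algebra_simps)

lemma lie_algebra_W3_family: "lie_algebra (W3_family \<sigma> \<tau> 0 0)"
  unfolding lie_algebra_def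
proof (intro conjI allI bilinear_map_W3_family)
  let ?\<mu> = "W3_family \<sigma> \<tau> 0 0"
  show "?\<mu> x x = 0" for x
    by (simp add: vec_eq_iff forall_5 algebra_simps)
  txt \<open>The bracket depends on its arguments only through the linear forms \<open>e3\<^sup>*\<close>, \<open>b\<close> and
    \<open>c\<close>, so that keeping \<open>b\<close> and \<open>c\<close> folded makes the Jacobi identity short.\<close>
  define b c where "b x = x $ 4 + \<sigma> * x $ 1" and "c x = x $ 5 + \<tau> * x $ 2" for x :: "'a ^ 5"
  have \<mu>: "?\<mu> x y = vector [x $ 3 * c y - c x * y $ 3, x $ 3 * b y - b x * y $ 3,
      b x * c y - c x * b y, \<sigma> * (x $ 3 * c y - c x * y $ 3), \<tau> * (x $ 3 * b y - b x * y $ 3)]" for x y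
    by (simp add: vec_eq_iff forall_5 b_def c_def algebra_simps)
  \<comment> \<open>Coordinates 1 and 4 of a bracket contribute the same term to \<open>b\<close>,
    as do 2 and 5 to \<open>c\<close>; hence the factors 2.\<close>
  have b: "b (?\<mu> x y) = 2 * \<sigma> * (x $ 3 * c y - c x * y $ 3)"
    and c: "c (?\<mu> x y) = 2 * \<tau> * (x $ 3 * b y - b x * y $ 3)" for x y
    by (simp_all add: \<mu> b_def[of "vector _"] c_def[of "vector _"])
  show "?\<mu> x (?\<mu> y z) + ?\<mu> y (?\<mu> z x) + ?\<mu> z (?\<mu> x y) = 0" for x y z
    unfolding \<mu>[of _ "?\<mu> _ _"] b c unfolding \<mu>
    by (simp add: vec_eq_iff forall_5 algebra_simps)
qed

text \<open>The symmetric terms take values in the central \<open>e 1\<close> and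
  \<open>e 2\<close>, and vanish when an argument is a bracket, whose coordinates 4 and 5 are 0.
  Only the Jacobi identity of \<open>W3\<close> remains.\<close>

lemma leibniz_algebra_W3_family: "leibniz_algebra (W3_family 0 0 \<alpha> \<beta>)"
  unfolding leibniz_algebra_def left_leibniz_def
  by (simp add: bilinear_map_W3_family) (simp add: vec_eq_iff forall_5 algebra_simps)

lemma W3_eq_family: "W3 = W3_family 0 0 0 0"
  by (intro ext) (simp add: W3_def lie_table_def vec_eq_iff forall_5 sum_5 axis_def algebra_simps)

lemma W3_tilde_eq_family: "W3_tilde = W3_family 0 0 1 0"
  by (intro ext) (simp add: W3_tilde_def W3_eq_family vec_eq_iff forall_5 axis_def)

lemma W3_tilde'_eq_family: "W3_tilde' = W3_family 0 0 0 1"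
  by (intro ext) (simp add: W3_tilde'_def W3_eq_family vec_eq_iff forall_5 axis_def)

section \<open>Isomorphisms of algebras\<close>

lemma linear_vecI:
  fixes f :: "complex ^ 'n \<Rightarrow> complex ^ 'm"
  assumes "\<And>x y. f (x + y) = f x + f y" "\<And>c x. f (c *s x) = c *s f x"
  shows "Vector_Spaces.linear (*s) (*s) f"
  using assms by unfold_locales

text \<open>A bijection is multiplicative as soon as its inverse is. Asking this of \<open>g\<close>
  moves the check from the coordinates of a direct sum to those of
  \<open>complex ^ 5\<close>.\<close>

lemma isomorphic_algebrasI:
  fixes f :: "complex ^ 'm \<Rightarrow> complex ^ 'n"
  assumes "\<And>x y. f (x + y) = f x + f y" "\<And>c x. f (c *s x) = c *s f x"
    and gf: "\<And>x. g (f x) = x" and fg: "\<And>y. f (g y) = y"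
    and hom: "\<And>x y. g (\<nu> x y) = \<mu> (g x) (g y)"
  shows "isomorphic_algebras \<mu> \<nu>"
  unfolding isomorphic_algebras_def
proof (intro exI conjI allI)
  show "Vector_Spaces.linear (*s) (*s) f"
    using assms(1,2) by (rule linear_vecI)
  show "bij f"
    using gf fg by (intro o_bij[of g]) auto
  show "f (\<mu> x y) = \<nu> (f x) (f y)" for x y
    by (metis gf fg hom)
qed

section \<open>Deformations of \<open>W3\<close> along lines in the parameter space\<close>

definition W3_deformation ::
  "complex \<Rightarrow> complex \<Rightarrow> complex \<Rightarrow> complex \<Rightarrow> nat \<Rightarrow> complex ^ 5 \<Rightarrow> complex ^ 5 \<Rightarrow> complex ^ 5"
  where "W3_deformation s r a b = coeff_family
    (W3_family (fps_const s * fps_X) (fps_const r * fps_X) (fps_const a * fps_X) (fps_const b * fps_X))"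

lemma W3_deformation_0: "W3_deformation s r a b 0 = W3"
  by (intro ext) (simp add: W3_deformation_def W3_eq_family coeff_family_def vec_eq_iff forall_5)

lemma W3_deformation_1 [simp]:
  "W3_deformation s r a b (Suc 0) x y $ 1 = r * (x $ 3 * y $ 2 - x $ 2 * y $ 3) + b * (x $ 4 * y $ 4)"
  "W3_deformation s r a b (Suc 0) x y $ 2 = s * (x $ 3 * y $ 1 - x $ 1 * y $ 3) + a * (x $ 5 * y $ 5)"
  "W3_deformation s r a b (Suc 0) x y $ 3 =
    s * (x $ 1 * y $ 5 - x $ 5 * y $ 1) + r * (x $ 4 * y $ 2 - x $ 2 * y $ 4)"
  "W3_deformation s r a b (Suc 0) x y $ 4 = s * (x $ 3 * y $ 5 - x $ 5 * y $ 3)"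
  "W3_deformation s r a b (Suc 0) x y $ 5 = r * (x $ 3 * y $ 4 - x $ 4 * y $ 3)"
  by (simp_all add: W3_deformation_def coeff_family_def mult.assoc)

text \<open>Only the product \<open>\<sigma> * \<tau>\<close> reaches order 2, so each nonzero entry
  has the factor \<open>s * r\<close>.\<close>

lemma W3_deformation_2 [simp]:
  "W3_deformation s r a b (Suc (Suc 0)) x y $ 1 = 0"
  "W3_deformation s r a b (Suc (Suc 0)) x y $ 2 = 0"
  "W3_deformation s r a b (Suc (Suc 0)) x y $ 3 = s * r * (x $ 1 * y $ 2 - x $ 2 * y $ 1)"
  "W3_deformation s r a b (Suc (Suc 0)) x y $ 4 = s * r * (x $ 3 * y $ 2 - x $ 2 * y $ 3)"
  "W3_deformation s r a b (Suc (Suc 0)) x y $ 5 = s * r * (x $ 3 * y $ 1 - x $ 1 * y $ 3)"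
  by (simp_all add: W3_deformation_def coeff_family_def mult.assoc)

lemma W3_deformation_eq_0:
  assumes "k > 2"
  shows "W3_deformation s r a b k = (\<lambda>x y. 0)"
proof -
  obtain j where "k = Suc (Suc (Suc j))"
    using assms by (metis less_imp_Suc_add numeral_2_eq_2 add_Suc)
  then show ?thesis
    by (intro ext) (simp add: W3_deformation_def coeff_family_def vec_eq_iff forall_5 mult.assoc)
qed

lemma polynomial_family_W3_deformation: "polynomial_family (W3_deformation s r a b)"
proof -
  have "{k. W3_deformation s r a b k \<noteq> (\<lambda>x y. 0)} \<subseteq> {..2}"
    using W3_deformation_eq_0 by (force simp: not_less[symmetric])
  then show ?thesis
    unfolding polynomial_family_def by (rule finite_subset) simp
qed

lemma specialization_W3_deformation:
  "specialization (W3_deformation s r a b) t = W3_family (s * t) (r * t) (a * t) (b * t)"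
proof (intro ext)
  fix x y
  have "specialization (W3_deformation s r a b) t x y = (\<Sum>k\<le>2. t ^ k *s W3_deformation s r a b k x y)"
    unfolding specialization_def
    by (rule sum.mono_neutral_left) (use W3_deformation_eq_0 in \<open>force simp: not_less[symmetric]\<close>)+
  also have "\<dots> = W3_family (s * t) (r * t) (a * t) (b * t) x y"
    by (simp add: numeral_2_eq_2 W3_deformation_0 W3_eq_family vec_eq_iff forall_5 algebra_simps)
  finally show "specialization (W3_deformation s r a b) t x y = W3_family (s * t) (r * t) (a * t) (b * t) x y" .
qed

text \<open>The two cases are the subfamilies shown to be Leibniz above:
  \<open>\<sigma> = \<tau> = 0\<close>, and the Lie brackets with
  \<open>\<alpha> = \<beta> = 0\<close>.\<close>

lemma deformation_W3_deformation:
  assumes "s = 0 \<and> r = 0 \<or> a = 0 \<and> b = 0"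
  shows "deformation W3 (W3_deformation s r a b)"
  unfolding deformation_def
proof (intro conjI allI)
  have bil: "bilinear_map (*s) (*s) (W3_family \<sigma> \<tau> \<alpha> \<beta>)" for \<sigma> \<tau> \<alpha> \<beta> :: "complex fps"
    by (rule bilinear_map_W3_family)
  show "leibniz_algebra W3"
    by (simp add: W3_eq_family leibniz_algebra_W3_family)
  show "W3_deformation s r a b 0 = W3"
    by (rule W3_deformation_0)
  show "bilinear_map (*s) (*s) (W3_deformation s r a b k)" for k
    unfolding W3_deformation_def using bil by (rule bilinear_map_coeff_family)
  show "leibniz_algebra (formal_bracket (W3_deformation s r a b))"
    unfolding W3_deformation_def formal_bracket_coeff_family[OF bil] using assms
    by (auto simp: leibniz_algebra_W3_family lie_algebra_imp_leibniz_algebra lie_algebra_W3_family)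
qed

lemma deformation_to_W3_deformation:
  assumes "s = 0 \<and> r = 0 \<or> a = 0 \<and> b = 0" and "leibniz_algebra \<nu>"
    and iso: "\<And>t. t \<noteq> 0 \<Longrightarrow> isomorphic_algebras (W3_family (s * t) (r * t) (a * t) (b * t)) \<nu>"
  shows "deformation_to W3 (W3_deformation s r a b) \<nu>"
proof -
  have "\<forall>\<^sub>F t in at 0. isomorphic_algebras (specialization (W3_deformation s r a b) t) \<nu>"
    using eventually_neq_at_within[of 0]
    by (rule eventually_mono) (simp add: specialization_W3_deformation iso)
  with assms show ?thesis
    by (simp add: deformation_to_def deformation_W3_deformation polynomial_family_W3_deformation)
qed

section \<open>Nilpotency and the invariant form\<close>

lemma nilpotent_algebra_W3_family: "nilpotent_algebra (W3_family 0 0 \<alpha> \<beta>)"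
proof -
  let ?L = "lower_central (W3_family 0 0 \<alpha> \<beta>)"
  \<comment> \<open>In the usual numbering this is \<open>L^2\<close>. Brackets lose
    \<open>e 4\<close> and \<open>e 5\<close>, the next step loses \<open>e 3\<close>, and
    \<open>e 1\<close>, \<open>e 2\<close> are central, so \<open>L^4 = 0\<close>.\<close>
  have "?L (Suc 0) \<subseteq> {x. x $ 4 = 0 \<and> x $ 5 = 0}"
    unfolding lower_central.simps
    by (rule vec.span_minimal) (auto simp: vec.subspace_def)
  then have "?L (Suc (Suc 0)) \<subseteq> {x. x $ 3 = 0 \<and> x $ 4 = 0 \<and> x $ 5 = 0}"
    unfolding lower_central.simps(2)[of _ "Suc 0"]
    by (intro vec.span_minimal) (auto simp: vec.subspace_def)
  then have "?L (Suc (Suc (Suc 0))) \<subseteq> {0}"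
    unfolding lower_central.simps(2)[of _ "Suc (Suc 0)"]
    by (intro vec.span_minimal) (auto simp: vec.subspace_def vec_eq_iff forall_5)
  moreover have "0 \<in> ?L (Suc (Suc (Suc 0)))"
    unfolding lower_central.simps(2)[of _ "Suc (Suc 0)"] by (rule vec.span_zero)
  ultimately show ?thesis
    unfolding nilpotent_algebra_def by blast
qed

definition W3_form :: "complex ^ 5 \<Rightarrow> complex ^ 5 \<Rightarrow> complex"
  where "W3_form x y = x $ 3 * y $ 3 - x $ 1 * y $ 4 - x $ 4 * y $ 1 + x $ 2 * y $ 5 + x $ 5 * y $ 2"

text \<open>An alternating 3-form plus cubes is cyclic in its three arguments; with the symmetry of
  \<open>W3_form\<close> this is invariance.\<close>

lemma metric_algebra_W3_family: "metric_algebra (W3_family \<sigma> \<tau> \<alpha> \<beta>)"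
  unfolding metric_algebra_def
proof (intro exI conjI allI impI)
  show "bilinear_map (*s) (*) W3_form"
    by (rule bilinear_map_formI) (simp_all add: W3_form_def algebra_simps)
  show "W3_form x y = W3_form y x" for x y
    by (simp add: W3_form_def algebra_simps)
  show "x = 0" if "\<forall>y. W3_form x y = 0" for x
    using that[THEN spec, of "axis 1 1"] that[THEN spec, of "axis 2 1"]
      that[THEN spec, of "axis 3 1"] that[THEN spec, of "axis 4 1"] that[THEN spec, of "axis 5 1"]
    by (simp add: W3_form_def axis_def vec_eq_iff forall_5)
  show "W3_form (W3_family \<sigma> \<tau> \<alpha> \<beta> x y) z = W3_form x (W3_family \<sigma> \<tau> \<alpha> \<beta> y z)" for x y z
    by (simp add: W3_form_def algebra_simps)
qed

section \<open>Isomorphism types of the deformed brackets\<close>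

lemma direct_sum_nth [simp]:
  "direct_sum \<mu> \<nu> x y $ Inl i = \<mu> (\<chi> a. x $ Inl a) (\<chi> a. y $ Inl a) $ i"
  "direct_sum \<mu> \<nu> x y $ Inr j = \<nu> (\<chi> b. x $ Inr b) (\<chi> b. y $ Inr b) $ j"
  by (simp_all add: direct_sum_def)

lemma abelian_nth [simp]: "abelian x y $ i = 0"
  by (simp add: abelian_def)

lemma diamond_nth [simp]:
  "diamond x y $ 1 = 0"
  "diamond x y $ 2 = x $ 3 * y $ 1 - x $ 1 * y $ 3"
  "diamond x y $ 3 = x $ 1 * y $ 2 - x $ 2 * y $ 1"
  "diamond x y $ 4 = x $ 2 * y $ 3 - x $ 3 * y $ 2"
  by (simp_all add: diamond_def lie_table_def sum_4 axis_def algebra_simps)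

lemma sl2_nth [simp]:
  "sl2 x y $ 1 = 2 * (x $ 3 * y $ 1 - x $ 1 * y $ 3)"
  "sl2 x y $ 2 = 2 * (x $ 2 * y $ 3 - x $ 3 * y $ 2)"
  "sl2 x y $ 3 = x $ 1 * y $ 2 - x $ 2 * y $ 1"
  by (simp_all add: sl2_def lie_table_def sum_3 axis_def algebra_simps)

lemma lie_algebra_diamond_abelian: "lie_algebra (direct_sum diamond (abelian :: complex ^ 1 \<Rightarrow> _))"
  unfolding lie_algebra_def
  by (intro conjI allI bilinear_map_vecI)
    (simp_all add: vec_eq_iff split_sum_all forall_4 algebra_simps)

lemma lie_algebra_sl2_abelian: "lie_algebra (direct_sum sl2 (abelian :: complex ^ 2 \<Rightarrow> _))"
  unfolding lie_algebra_def
  by (intro conjI allI bilinear_map_vecI)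
    (simp_all add: vec_eq_iff split_sum_all forall_3 algebra_simps)

lemma W3_family_iso_diamond1:
  assumes "s \<noteq> 0"
  shows "isomorphic_algebras (W3_family s 0 0 0) (direct_sum diamond (abelian :: complex ^ 1 \<Rightarrow> _))"
proof -
  txt \<open>Put \<open>u = e1 + s e4\<close>.  Then \<open>[e5, e3] = - u\<close> and \<open>[e5, u] = - 2 s e3\<close>, so \<open>c e5\<close>
    rotates the plane of \<open>e3\<close> and \<open>c u\<close> if \<open>2 s c\<^sup>2 = - 1\<close>; and \<open>e1 - s e4\<close> is central.
    In the coordinate map \<open>?f\<close> below, \<open>1 / c\<close> is written as \<open>- 2 s c\<close>.\<close>
  define c where "c = csqrt (- 1 / (2 * s))"
  have c: "c * (c * (s * w)) = - w / 2" for w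
    using assms by (simp add: c_def mult.assoc[symmetric] power2_eq_square[symmetric])
  define q where "q = 1 / s"
  have q: "s * (q * w) = w" "q * (s * w) = w" and c': "c * (c * w) = - (q * w) / 2" for w
    using assms c[of "q * w"] by (simp_all add: q_def)
  let ?f = "\<lambda>x :: complex ^ 5. \<chi> k :: 4 + 1. case k of
      Inl i \<Rightarrow> vector [- 2 * s * c * x $ 5, x $ 3, c * (s * x $ 1 + x $ 4), c * x $ 2] $ i
    | Inr j \<Rightarrow> (q * x $ 4 - x $ 1) / 2"
  let ?g = "\<lambda>d :: complex ^ (4 + 1). vector [- c * d $ Inl 3 - d $ Inr 1, - 2 * s * c * d $ Inl 4,
    d $ Inl 2, s * (d $ Inr 1 - c * d $ Inl 3), c * d $ Inl 1] :: complex ^ 5"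
  show ?thesis
  proof (rule isomorphic_algebrasI[of ?f ?g])
    show "?g (?f x) = x" for x
      by (simp add: vec_eq_iff forall_5 algebra_simps c c' q) (simp add: field_simps)
    show "?f (?g y) = y" for y
      by (simp add: vec_eq_iff split_sum_all forall_4 algebra_simps c c' q)
    show "?g (direct_sum diamond abelian x y) = W3_family s 0 0 0 (?g x) (?g y)" for x y
      by (simp add: vec_eq_iff forall_5 algebra_simps c)
  qed (simp_all add: vec_eq_iff split_sum_all forall_4 algebra_simps add_divide_distrib diff_divide_distrib)
qed

lemma W3_family_iso_diamond2:
  assumes "r \<noteq> 0"
  shows "isomorphic_algebras (W3_family 0 r 0 0) (direct_sum diamond (abelian :: complex ^ 1 \<Rightarrow> _))"
proof -
  txt \<open>As before, now with \<open>e4\<close>, \<open>e2 + r e5\<close> and \<open>e2 - r e5\<close> in place of \<open>e5\<close>, \<open>u\<close> and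
    \<open>e1 - s e4\<close>, and \<open>2 r c\<^sup>2 = 1\<close>.\<close>
  define c where "c = csqrt (1 / (2 * r))"
  have c: "c * (c * (r * w)) = w / 2" for w
    using assms by (simp add: c_def mult.assoc[symmetric] power2_eq_square[symmetric])
  define q where "q = 1 / r"
  have q: "r * (q * w) = w" "q * (r * w) = w" and c': "c * (c * w) = q * w / 2" for w
    using assms c[of "q * w"] by (simp_all add: q_def)
  let ?f = "\<lambda>x :: complex ^ 5. \<chi> k :: 4 + 1. case k of
      Inl i \<Rightarrow> vector [2 * r * c * x $ 4, x $ 3, - c * (r * x $ 2 + x $ 5), - c * x $ 1] $ i
    | Inr j \<Rightarrow> (x $ 2 - q * x $ 5) / 2"
  let ?g = "\<lambda>d :: complex ^ (4 + 1). vector [- 2 * r * c * d $ Inl 4, d $ Inr 1 - c * d $ Inl 3,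
    d $ Inl 2, c * d $ Inl 1, - r * (c * d $ Inl 3 + d $ Inr 1)] :: complex ^ 5"
  show ?thesis
  proof (rule isomorphic_algebrasI[of ?f ?g])
    show "?g (?f x) = x" for x
      by (simp add: vec_eq_iff forall_5 algebra_simps c c' q) (simp add: field_simps)
    show "?f (?g y) = y" for y
      by (simp add: vec_eq_iff split_sum_all forall_4 algebra_simps c c' q)
    show "?g (direct_sum diamond abelian x y) = W3_family 0 r 0 0 (?g x) (?g y)" for x y
      by (simp add: vec_eq_iff forall_5 algebra_simps c)
  qed (simp_all add: vec_eq_iff split_sum_all forall_4 algebra_simps add_divide_distrib diff_divide_distrib)
qed

lemma W3_family_iso_sl2:
  assumes "t \<noteq> 0"
  shows "isomorphic_algebras (W3_family t t 0 0) (direct_sum sl2 (abelian :: complex ^ 2 \<Rightarrow> _))"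
proof -
  txt \<open>With \<open>u = e1 + t e4\<close> and \<open>v = e2 + t e5\<close> one has \<open>[e3, u] = 2 t v\<close>, \<open>[e3, v] = 2 t u\<close> and
    \<open>[u, v] = 4 t\<^sup>2 e3\<close>, so \<open>u + v\<close>, \<open>(v - u) / (8 t\<^sup>3)\<close>, \<open>e3 / t\<close> is the standard basis of
    \<open>sl2\<close>; and \<open>e1 - t e4\<close>, \<open>e2 - t e5\<close> are central.\<close>
  define q n w where "q = 1 / t" and "n = 8 * t ^ 3" and "w = 1 / n"
  have q: "q * (t * z) = z" "t * (q * z) = z" and w: "t * (t * (w * z)) = q * z / 8"
    and n: "n * (w * z) = z" "w * (n * z) = z" for z
    using assms by (simp_all add: q_def w_def n_def power3_eq_cube)
  let ?f = "\<lambda>x :: complex ^ 5. \<chi> k :: 3 + 2. case k of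
      Inl i \<Rightarrow> vector [((x $ 1 + q * x $ 4) + (x $ 2 + q * x $ 5)) / 4,
        n * (((x $ 2 + q * x $ 5) - (x $ 1 + q * x $ 4)) / 4), t * x $ 3] $ i
    | Inr j \<Rightarrow> vector [(x $ 1 - q * x $ 4) / 2, (x $ 2 - q * x $ 5) / 2] $ j"
  let ?g = "\<lambda>d :: complex ^ (3 + 2). vector [d $ Inl 1 - w * d $ Inl 2 + d $ Inr 1,
    d $ Inl 1 + w * d $ Inl 2 + d $ Inr 2, q * d $ Inl 3,
    t * (d $ Inl 1 - w * d $ Inl 2 - d $ Inr 1),
    t * (d $ Inl 1 + w * d $ Inl 2 - d $ Inr 2)] :: complex ^ 5"
  show ?thesis
  proof (rule isomorphic_algebrasI[of ?f ?g])
    show "?g (?f x) = x" for x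
      by (simp add: vec_eq_iff forall_5 n q) (simp add: field_simps q)
    show "?f (?g y) = y" for y
      by (simp add: vec_eq_iff split_sum_all forall_3 forall_2 q n)
    show "?g (direct_sum sl2 abelian x y) = W3_family t t 0 0 (?g x) (?g y)" for x y
      by (simp add: vec_eq_iff forall_5 algebra_simps q w)
  qed (simp_all add: vec_eq_iff split_sum_all forall_3 forall_2 add_divide_distrib
      diff_divide_distrib algebra_simps)
qed

lemma W3_family_iso_W3_tilde:
  assumes "t \<noteq> 0"
  shows "isomorphic_algebras (W3_family 0 0 t 0) W3_tilde"
proof -
  \<comment> \<open>Scaling \<open>e 4\<close> by 1 and \<open>e 5\<close> by \<open>k\<close>
    forces \<open>k\<close> on \<open>e 3\<close> and \<open>e 2\<close>, and \<open>k^2\<close> on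
    \<open>e 1\<close>. The square of \<open>e 5\<close> then requires
    \<open>t * k = k^2\<close>.\<close>
  let ?c = "vector [t\<^sup>2, t, t, 1, t] :: complex ^ 5"
  show ?thesis
    by (rule isomorphic_algebrasI[of "\<lambda>x. \<chi> i. ?c $ i * x $ i" "\<lambda>y. \<chi> i. y $ i / ?c $ i"])
      (use assms in \<open>simp_all add: W3_tilde_eq_family vec_eq_iff forall_5 field_simps power2_eq_square\<close>)
qed

lemma W3_family_iso_W3_tilde':
  assumes "t \<noteq> 0"
  shows "isomorphic_algebras (W3_family 0 0 0 t) W3_tilde'"
proof -
  \<comment> \<open>The same scaling with \<open>e 4\<close> and \<open>e 5\<close> exchanged, as
    well as \<open>e 1\<close> and \<open>e 2\<close>.\<close>
  let ?c = "vector [t, t\<^sup>2, t, t, 1] :: complex ^ 5"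
  show ?thesis
    by (rule isomorphic_algebrasI[of "\<lambda>x. \<chi> i. ?c $ i * x $ i" "\<lambda>y. \<chi> i. y $ i / ?c $ i"])
      (use assms in \<open>simp_all add: W3_tilde'_eq_family vec_eq_iff forall_5 field_simps power2_eq_square\<close>)
qed

lemma W3_tilde_iso_W3_tilde': "isomorphic_algebras W3_tilde W3_tilde'"
proof -
  \<comment> \<open>A quarter turn of the plane of \<open>e 4\<close> and \<open>e 5\<close> has
    determinant 1, so it fixes \<open>e 3\<close>; it turns the square of \<open>e 5\<close> into
    that of \<open>e 4\<close>.\<close>
  let ?f = "\<lambda>x :: complex ^ 5. vector [x $ 2, - x $ 1, x $ 3, - x $ 5, x $ 4] :: complex ^ 5"
  let ?g = "\<lambda>y :: complex ^ 5. vector [- y $ 2, y $ 1, y $ 3, y $ 5, - y $ 4] :: complex ^ 5"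
  show ?thesis
    by (rule isomorphic_algebrasI[of ?f ?g])
      (simp_all add: W3_tilde_eq_family W3_tilde'_eq_family vec_eq_iff forall_5)
qed

section \<open>Independence of the infinitesimal cocycles\<close>

lemma independent_classes_diamond:
  "independent_classes W3 (W3_deformation 1 0 0 0 1) (W3_deformation 0 1 0 0 1)"
  unfolding independent_classes_def
proof (intro allI impI)
  fix a b
  assume "coboundary W3 (\<lambda>x y. a *s W3_deformation 1 0 0 0 1 x y + b *s W3_deformation 0 1 0 0 1 x y)"
  then obtain f where f: "Vector_Spaces.linear (*s) (*s) f"
    and eq: "a *s W3_deformation 1 0 0 0 1 x y + b *s W3_deformation 0 1 0 0 1 x y
      = W3 x (f y) + W3 (f x) y - f (W3 x y)" for x y
    unfolding coboundary_def by blast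
  have "W3 (axis 1 1) (axis 5 1) = 0" "W3 (axis 3 1) (axis 5 1) = axis 1 1"
    "W3 (axis 4 1) (axis 2 1) = 0" "W3 (axis 3 1) (axis 4 1) = axis 2 1"
    by (simp_all add: W3_eq_family vec_eq_iff forall_5 axis_def)
  moreover have "f 0 = 0"
    using f by (rule vec.linear_0)
  txt \<open>The pairs \<open>(e1, e5)\<close> and \<open>(e3, e5)\<close> show that \<open>a\<close> is both the \<open>e4\<close>-coordinate of
    \<open>f e1\<close> and its negative; likewise \<open>b\<close> and the \<open>e5\<close>-coordinate of \<open>f e2\<close>.\<close>
  ultimately show "a = 0 \<and> b = 0"
    using arg_cong[OF eq[of "axis 1 1" "axis 5 1"], of "\<lambda>v. v $ 3"]
      arg_cong[OF eq[of "axis 3 1" "axis 5 1"], of "\<lambda>v. v $ 4"]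
      arg_cong[OF eq[of "axis 4 1" "axis 2 1"], of "\<lambda>v. v $ 3"]
      arg_cong[OF eq[of "axis 3 1" "axis 4 1"], of "\<lambda>v. v $ 5"]
    by (simp add: W3_eq_family axis_def)
qed

lemma independent_classes_tilde:
  "independent_classes W3 (W3_deformation 0 0 1 0 1) (W3_deformation 0 0 0 1 1)"
  unfolding independent_classes_def
proof (intro allI impI)
  txt \<open>A coboundary of \<open>W3\<close> is alternating.\<close>
  fix a b
  assume "coboundary W3 (\<lambda>x y. a *s W3_deformation 0 0 1 0 1 x y + b *s W3_deformation 0 0 0 1 1 x y)"
  then obtain f where f: "Vector_Spaces.linear (*s) (*s) f"
    and eq: "a *s W3_deformation 0 0 1 0 1 x y + b *s W3_deformation 0 0 0 1 1 x y
      = W3 x (f y) + W3 (f x) y - f (W3 x y)" for x y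
    unfolding coboundary_def by blast
  have "W3 x (f x) + W3 (f x) x - f (W3 x x) = 0" for x
  proof -
    have "W3 x (f x) + W3 (f x) x = 0" "W3 x x = 0"
      by (simp_all add: W3_eq_family vec_eq_iff forall_5 algebra_simps)
    then show ?thesis
      using vec.linear_0[OF f] by simp
  qed
  \<comment> \<open>The diagonal values at \<open>e5\<close> and \<open>e4\<close> are
    \<open>a *s e 2\<close> and \<open>b *s e 1\<close>.\<close>
  then show "a = 0 \<and> b = 0"
    using arg_cong[OF eq[of "axis 5 1" "axis 5 1"], of "\<lambda>v. v $ 2"]
      arg_cong[OF eq[of "axis 4 1" "axis 4 1"], of "\<lambda>v. v $ 1"]
    by (simp add: axis_def)
qed

theorem theorem5p3:
  shows "(lie_algebra W3 \<and> nilpotent_algebra W3) \<and>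
    (lie_algebra (direct_sum diamond (abelian :: complex ^ 1 \<Rightarrow> _)) \<and>
      (\<exists>\<phi> \<psi>.
        deformation_to W3 \<phi> (direct_sum diamond (abelian :: complex ^ 1 \<Rightarrow> _)) \<and>
        deformation_to W3 \<psi> (direct_sum diamond (abelian :: complex ^ 1 \<Rightarrow> _)) \<and>
        independent_classes W3 (\<phi> 1) (\<psi> 1))) \<and>
    (lie_algebra (direct_sum sl2 (abelian :: complex ^ 2 \<Rightarrow> _)) \<and>
      (\<exists>\<phi>. deformation_to W3 \<phi> (direct_sum sl2 (abelian :: complex ^ 2 \<Rightarrow> _)))) \<and>
    (leibniz_algebra W3_tilde \<and> nilpotent_algebra W3_tilde \<and> metric_algebra W3_tilde) \<and>
    (leibniz_algebra W3_tilde' \<and> nilpotent_algebra W3_tilde' \<and> metric_algebra W3_tilde') \<and>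
    (\<exists>\<phi> \<psi>.
      deformation_to W3 \<phi> W3_tilde \<and>
      deformation_to W3 \<psi> W3_tilde' \<and>
      independent_classes W3 (\<phi> 1) (\<psi> 1)) \<and>
    isomorphic_algebras W3_tilde W3_tilde'"
proof (intro conjI)
  let ?d = "direct_sum diamond (abelian :: complex ^ 1 \<Rightarrow> _)"
  let ?s = "direct_sum sl2 (abelian :: complex ^ 2 \<Rightarrow> _)"
  show "lie_algebra W3" "nilpotent_algebra W3"
    by (simp_all add: W3_eq_family lie_algebra_W3_family nilpotent_algebra_W3_family)
  show "lie_algebra ?d" "lie_algebra ?s"
    by (rule lie_algebra_diamond_abelian lie_algebra_sl2_abelian)+
  have "deformation_to W3 (W3_deformation 1 0 0 0) ?d" "deformation_to W3 (W3_deformation 0 1 0 0) ?d"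
    by (rule deformation_to_W3_deformation;
        simp add: lie_algebra_diamond_abelian lie_algebra_imp_leibniz_algebra
          W3_family_iso_diamond1 W3_family_iso_diamond2)+
  with independent_classes_diamond
  show "\<exists>\<phi> \<psi>. deformation_to W3 \<phi> ?d \<and> deformation_to W3 \<psi> ?d \<and> independent_classes W3 (\<phi> 1) (\<psi> 1)"
    by blast
  \<comment> \<open>Both factors of the 3-form move at equal speed, which keeps
    \<open>\<sigma> = \<tau> = t\<close>.\<close>
  have "deformation_to W3 (W3_deformation 1 1 0 0) ?s"
    by (rule deformation_to_W3_deformation;
        simp add: lie_algebra_sl2_abelian lie_algebra_imp_leibniz_algebra W3_family_iso_sl2)
  then show "\<exists>\<phi>. deformation_to W3 \<phi> ?s"
    by blast
  show tilde: "leibniz_algebra W3_tilde" "leibniz_algebra W3_tilde'"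
    and "nilpotent_algebra W3_tilde" "nilpotent_algebra W3_tilde'"
      "metric_algebra W3_tilde" "metric_algebra W3_tilde'"
    by (simp_all add: W3_tilde_eq_family W3_tilde'_eq_family leibniz_algebra_W3_family
        nilpotent_algebra_W3_family metric_algebra_W3_family)
  have "deformation_to W3 (W3_deformation 0 0 1 0) W3_tilde"
    "deformation_to W3 (W3_deformation 0 0 0 1) W3_tilde'"
    by (rule deformation_to_W3_deformation;
        simp add: tilde W3_family_iso_W3_tilde W3_family_iso_W3_tilde')+
  with independent_classes_tilde
  show "\<exists>\<phi> \<psi>. deformation_to W3 \<phi> W3_tilde \<and> deformation_to W3 \<psi> W3_tilde' \<and>
      independent_classes W3 (\<phi> 1) (\<psi> 1)"
    by blast
  show "isomorphic_algebras W3_tilde W3_tilde'"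
    by (rule W3_tilde_iso_W3_tilde')
qed

end
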